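(* The behavioral presheaf $\mathcal{F}_j^{\mathrm{beh}}$ does not satisfy the gluing axiom in general. Explicitly, let $\mathcal{S}$ be the system with $S_b=S_a=\{s_0,s_1,s_2,s_3\}$, $I=\{a,b\}$, $O=\{0,1\}$ and dynamics $$\alpha(s_0,a)=(s_0,0),\quad \alpha(s_0,b)=(s_2,0),\quad \alpha(s_1,a)=\alpha(s_1,b)=(s_1,1),$$ $$\alpha(s_2,a)=\alpha(s_2,b)=(s_1,1),\quad \alpha(s_3,a)=(s_3,1),\quad \alpha(s_3,b)=(s_2,1),$$ with judge $j_I:\{a,b\}\to\{\bullet\}$ the constant map and $j_O=\mathrm{id}$. Let $\mathcal{S}_1$ and $\mathcal{S}_2$ be the restrictions of $\mathcal{S}$ to the states $\{s_0,s_1,s_2\}$ and $\{s_1,s_2,s_3\}$ respectively (with all inputs and outputs); these form a covering of $\mathcal{S}$. Let $M_1$ be the homogeneous machine with states $p_0,p_1$, input set $\{\bullet\}$ and output set $\{0,1\}$, in which $p_0$ has constant output $0$ and $p_1$ has constant output $1$ (each state returning to itself), and let $M_2$ be the one-state machine with state $q$, the same interface, and constant output $1$. Then there are sections $(M_1,\psi_1)$ over $\mathcal{S}_1$ with $\psi_{1,b}(s_0)=p_0$, $\psi_{1,b}(s_1)=\psi_{1,b}(s_2)=p_1$, and $(M_2,\psi_2)$ over $\mathcal{S}_2$ with $\psi_{2,b}(s_1)=\psi_{2,b}(s_2)=\psi_{2,b}(s_3)=q$, whose classes in $\mathcal{F}_j^{\mathrm{beh}}(\mathcal{S}_1)$ and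 $\mathcal{F}_j^{\mathrm{beh}}(\mathcal{S}_2)$ have equal restrictions to the overlap $\mathcal{S}_1\cap\mathcal{S}_2$ (states $\{s_1,s_2\}$), but there is no element of $\mathcal{F}_j^{\mathrm{beh}}(\mathcal{S})$ restricting to both of these classes.
   Context: All sets are definable in an o-minimal structure $\mathrm{M}$ expanding $(\mathbb{R},<,+,\cdot)$ and all maps are definable (finite sets are definable and discrete, so every subset is open). A system is $\mathcal{S}=(S_b,S_a,I,O,\alpha)$ with $\alpha:S_b\times I\to S_a\times O$. A morphism is a 4-tuple $(f_b,f_a,f_I,f_O)$ with $(f_a\times f_O)\circ\alpha=\alpha'\circ(f_b\times f_I)$. A definable open immersion of systems is a morphism each of whose components is the inclusion of a definable open subset. A finite family $\{\mathcal{S}_\alpha\hookrightarrow\mathcal{S}\}$ of such is a covering if $\bigsqcup_\alpha(S_{\alpha,b}\times I_\alpha)\to S_b\times I$ and $\bigsqcup_\alpha(S_{\alpha,a}\times O_\alpha)\to S_a\times O$ are surjective. A system is homogeneous if before-states and after-states coincide. A judge for $\mathcal{S}$ is a pair of definable maps $j_I:I\to I'$, $j_O:O\to O'$. For an open immersion $m:\mathcal{S}_U\hookrightarrow\mathcal{S}$, $\tilde{\mathcal{F}}_j(\mathcal{S}_U)$ is the set of pairs (sections) $(\mathcal{S}',\psi)$ with $\mathcal{S}'=(S',S',I',O',\alpha')$ a homogeneous system with interface $(I',O')$ and $\psi:\mathcal{S}_U\to\mathcal{S}'$ a morphism with $\psi_I=j_I\circ m_I$, $\psi_O=j_O\circ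 m_O$; the components $\psi_b:S_{U,b}\to S'$ and $\psi_a:S_{U,a}\to S'$ may differ. Restriction is by precomposition. Two sections $(\mathcal{S}_1',\psi_1),(\mathcal{S}_2',\psi_2)$ over $\mathcal{S}_U$ are behaviorally equivalent ($\approx$) if for every $x\in S_{U,b}$ and every finite input sequence in $I'$, the output sequences from $\psi_{1,b}(x)$ in $\mathcal{S}_1'$ and from $\psi_{2,b}(x)$ in $\mathcal{S}_2'$ coincide. $\mathcal{F}_j^{\mathrm{beh}}:=\tilde{\mathcal{F}}_j/{\approx}$. The gluing axiom requires that, for every covering, every family of classes over the patches that agree on pairwise overlaps is the family of restrictions of some class over the covered system. *)

theory Defs
  imports Complex_Main "HOL-Library.FuncSet"
begin

text \<open>Points of the n-dimensional real space are the real lists of length n; the product of two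
  such spaces is then given by concatenation.\<close>

type_synonym pt = "real list"

definition rspace :: "nat \<Rightarrow> pt set" where
  "rspace n = {x. length x = n}"

text \<open>An o-minimal structure expanding the ordered field of reals, given as usual (van den Dries)
  by the family \<open>D\<close> of its definable sets, \<open>D n\<close> being the definable subsets of
  \<open>rspace n\<close>. Definability is with real parameters: all singletons belong to \<open>D 1\<close>.\<close>

locale ominimal =
  fixes D :: "nat \<Rightarrow> pt set set"
  assumes subset_rspace: "A \<in> D n \<Longrightarrow> A \<subseteq> rspace n"
    and empty: "{} \<in> D n"
    and union: "A \<in> D n \<Longrightarrow> B \<in> D n \<Longrightarrow> A \<union> B \<in> D n"
    and compl: "A \<in> D n \<Longrightarrow> rspace n - A \<in> D n"
    and prod_left: "A \<in> D n \<Longrightarrow> {r # x | r x. x \<in> A} \<in> D (Suc n)"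
    and prod_right: "A \<in> D n \<Longrightarrow> {x @ [r] | r x. x \<in> A} \<in> D (Suc n)"
    and diagonal: "i < n \<Longrightarrow> j < n \<Longrightarrow> {x \<in> rspace n. x ! i = x ! j} \<in> D n"
    and projection: "A \<in> D (Suc n) \<Longrightarrow> butlast ` A \<in> D n"
    and less: "{[x, y] | x y. x < y} \<in> D 2"
    and add: "{[x, y, x + y] | x y. True} \<in> D 3"
    and mult: "{[x, y, x * y] | x y. True} \<in> D 3"
    and one_dim: "A \<in> D 1 \<longleftrightarrow>
      (\<exists>F. finite F \<and> A = (\<lambda>r. [r]) ` \<Union>F \<and>
        (\<forall>J\<in>F. (\<exists>a. J = {a}) \<or> (\<exists>a b. J = {a<..<b}) \<or> (\<exists>a. J = {..<a}) \<or>
               (\<exists>a. J = {a<..}) \<or> J = UNIV))"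

definition definable :: "(nat \<Rightarrow> pt set set) \<Rightarrow> pt set \<Rightarrow> bool" where
  "definable D A \<longleftrightarrow> (\<exists>n. A \<in> D n)"

text \<open>Maps are extensional (\<open>undefined\<close> off their domain), so that equality of maps is equality
  of HOL functions. The points of a definable set all have the same length, so concatenation
  loses no information in the graph.\<close>

definition definable_map :: "(nat \<Rightarrow> pt set set) \<Rightarrow> pt set \<Rightarrow> pt set \<Rightarrow> (pt \<Rightarrow> pt) \<Rightarrow> bool" where
  "definable_map D X Y f \<longleftrightarrow> f \<in> X \<rightarrow>\<^sub>E Y \<and> definable D {x @ f x | x. x \<in> X}"

text \<open>Relative openness for the Euclidean topology, via the sup metric.\<close>

definition open_within :: "pt set \<Rightarrow> pt set \<Rightarrow> bool" where
  "open_within U X \<longleftrightarrow> U \<subseteq> X \<and>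
     (\<forall>x\<in>U. \<exists>e>0. \<forall>y\<in>X. (\<forall>i<length x. \<bar>y ! i - x ! i\<bar> < e) \<longrightarrow> y \<in> U)"

record system =
  before :: "pt set"
  after :: "pt set"
  inputs :: "pt set"
  outputs :: "pt set"
  dyn :: "pt \<times> pt \<Rightarrow> pt \<times> pt"

definition is_system :: "(nat \<Rightarrow> pt set set) \<Rightarrow> system \<Rightarrow> bool" where
  "is_system D S \<longleftrightarrow>
     definable D (before S) \<and> definable D (after S) \<and>
     definable D (inputs S) \<and> definable D (outputs S) \<and>
     dyn S \<in> before S \<times> inputs S \<rightarrow>\<^sub>E after S \<times> outputs S \<and>
     definable D {s @ i @ fst (dyn S (s, i)) @ snd (dyn S (s, i)) | s i.
                    s \<in> before S \<and> i \<in> inputs S}"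

definition homogeneous :: "system \<Rightarrow> bool" where
  "homogeneous S \<longleftrightarrow> before S = after S"

record morphism =
  on_before :: "pt \<Rightarrow> pt"
  on_after :: "pt \<Rightarrow> pt"
  on_inputs :: "pt \<Rightarrow> pt"
  on_outputs :: "pt \<Rightarrow> pt"

definition is_morphism :: "(nat \<Rightarrow> pt set set) \<Rightarrow> morphism \<Rightarrow> system \<Rightarrow> system \<Rightarrow> bool" where
  "is_morphism D f S S' \<longleftrightarrow>
     is_system D S \<and> is_system D S' \<and>
     definable_map D (before S) (before S') (on_before f) \<and>
     definable_map D (after S) (after S') (on_after f) \<and>
     definable_map D (inputs S) (inputs S') (on_inputs f) \<and>
     definable_map D (outputs S) (outputs S') (on_outputs f) \<and>
     (\<forall>s\<in>before S. \<forall>i\<in>inputs S.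
        map_prod (on_after f) (on_outputs f) (dyn S (s, i)) =
        dyn S' (on_before f s, on_inputs f i))"

text \<open>\<open>mor_comp S g f\<close> is g after f, where S is the source of f.\<close>

definition mor_comp :: "system \<Rightarrow> morphism \<Rightarrow> morphism \<Rightarrow> morphism" where
  "mor_comp S g f =
     \<lparr>on_before = compose (before S) (on_before g) (on_before f),
      on_after = compose (after S) (on_after g) (on_after f),
      on_inputs = compose (inputs S) (on_inputs g) (on_inputs f),
      on_outputs = compose (outputs S) (on_outputs g) (on_outputs f)\<rparr>"

definition incl :: "system \<Rightarrow> morphism" where
  "incl U = \<lparr>on_before = (\<lambda>x\<in>before U. x), on_after = (\<lambda>x\<in>after U. x),
             on_inputs = (\<lambda>x\<in>inputs U. x), on_outputs = (\<lambda>x\<in>outputs U. x)\<rparr>"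

text \<open>An open immersion into S is determined by its source, its underlying morphism being the
  inclusion.\<close>

definition open_immersion :: "(nat \<Rightarrow> pt set set) \<Rightarrow> system \<Rightarrow> system \<Rightarrow> bool" where
  "open_immersion D U S \<longleftrightarrow>
     is_morphism D (incl U) U S \<and>
     open_within (before U) (before S) \<and> open_within (after U) (after S) \<and>
     open_within (inputs U) (inputs S) \<and> open_within (outputs U) (outputs S)"

definition covering :: "(nat \<Rightarrow> pt set set) \<Rightarrow> system list \<Rightarrow> system \<Rightarrow> bool" where
  "covering D Us S \<longleftrightarrow>
     (\<forall>U\<in>set Us. open_immersion D U S) \<and>
     (\<Union>U\<in>set Us. before U \<times> inputs U) = before S \<times> inputs S \<and>
     (\<Union>U\<in>set Us. after U \<times> outputs U) = after S \<times> outputs S"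

text \<open>Meant for open subsystems of a common system, whose dynamics agree where both are defined.\<close>

definition overlap :: "system \<Rightarrow> system \<Rightarrow> system" where
  "overlap U V =
     \<lparr>before = before U \<inter> before V, after = after U \<inter> after V,
      inputs = inputs U \<inter> inputs V, outputs = outputs U \<inter> outputs V,
      dyn = restrict (dyn U) ((before U \<inter> before V) \<times> (inputs U \<inter> inputs V))\<rparr>"

record judge =
  judged_inputs :: "pt set"
  judged_outputs :: "pt set"
  judge_in :: "pt \<Rightarrow> pt"
  judge_out :: "pt \<Rightarrow> pt"

definition is_judge :: "(nat \<Rightarrow> pt set set) \<Rightarrow> judge \<Rightarrow> system \<Rightarrow> bool" where
  "is_judge D j S \<longleftrightarrow>
     definable D (judged_inputs j) \<and> definable D (judged_outputs j) \<and>
     definable_map D (inputs S) (judged_inputs j) (judge_in j) \<and>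
     definable_map D (outputs S) (judged_outputs j) (judge_out j)"

text \<open>Here U is an open subsystem of the system judged by j; the immersion is \<open>incl U\<close>.\<close>

definition judge_sections ::
    "(nat \<Rightarrow> pt set set) \<Rightarrow> judge \<Rightarrow> system \<Rightarrow> (system \<times> morphism) set" where
  "judge_sections D j U =
     {(S', \<psi>). is_system D S' \<and> homogeneous S' \<and>
        inputs S' = judged_inputs j \<and> outputs S' = judged_outputs j \<and>
        is_morphism D \<psi> U S' \<and>
        on_inputs \<psi> = compose (inputs U) (judge_in j) (on_inputs (incl U)) \<and>
        on_outputs \<psi> = compose (outputs U) (judge_out j) (on_outputs (incl U))}"

definition restrict_sec :: "system \<Rightarrow> system \<times> morphism \<Rightarrow> system \<times> morphism" where
  "restrict_sec V = (\<lambda>(S', \<psi>). (S', mor_comp V \<psi> (incl V)))"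

fun output_seq :: "system \<Rightarrow> pt \<Rightarrow> pt list \<Rightarrow> pt list" where
  "output_seq S s [] = []"
| "output_seq S s (i # w) = (case dyn S (s, i) of (s', z) \<Rightarrow> z # output_seq S s' w)"

definition beh_equiv ::
    "(nat \<Rightarrow> pt set set) \<Rightarrow> judge \<Rightarrow> system \<Rightarrow> (system \<times> morphism) rel" where
  "beh_equiv D j U =
     {((S\<^sub>1, \<psi>\<^sub>1), (S\<^sub>2, \<psi>\<^sub>2)).
        (S\<^sub>1, \<psi>\<^sub>1) \<in> judge_sections D j U \<and> (S\<^sub>2, \<psi>\<^sub>2) \<in> judge_sections D j U \<and>
        (\<forall>x\<in>before U. \<forall>w\<in>lists (judged_inputs j).
           output_seq S\<^sub>1 (on_before \<psi>\<^sub>1 x) w = output_seq S\<^sub>2 (on_before \<psi>\<^sub>2 x) w)}"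

definition beh_presheaf ::
    "(nat \<Rightarrow> pt set set) \<Rightarrow> judge \<Rightarrow> system \<Rightarrow> (system \<times> morphism) set set" where
  "beh_presheaf D j U = judge_sections D j U // beh_equiv D j U"

definition beh_class ::
    "(nat \<Rightarrow> pt set set) \<Rightarrow> judge \<Rightarrow> system \<Rightarrow> system \<times> morphism \<Rightarrow> (system \<times> morphism) set" where
  "beh_class D j U \<sigma> = beh_equiv D j U `` {\<sigma>}"

text \<open>The map on classes induced by restriction to V: the class over V of the restriction of any
  representative.\<close>

definition restrict_class ::
    "(nat \<Rightarrow> pt set set) \<Rightarrow> judge \<Rightarrow> system \<Rightarrow> (system \<times> morphism) set \<Rightarrow>
     (system \<times> morphism) set" where
  "restrict_class D j V c = beh_equiv D j V `` (restrict_sec V ` c)"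

definition beh_gluing_axiom :: "(nat \<Rightarrow> pt set set) \<Rightarrow> judge \<Rightarrow> system \<Rightarrow> bool" where
  "beh_gluing_axiom D j S \<longleftrightarrow>
     (\<forall>T Us cs. open_immersion D T S \<and> covering D Us T \<and> length cs = length Us \<and>
        (\<forall>k<length Us. cs ! k \<in> beh_presheaf D j (Us ! k)) \<and>
        (\<forall>k<length Us. \<forall>l<length Us.
           restrict_class D j (overlap (Us ! k) (Us ! l)) (cs ! k) =
           restrict_class D j (overlap (Us ! k) (Us ! l)) (cs ! l))
        \<longrightarrow> (\<exists>d\<in>beh_presheaf D j T. \<forall>k<length Us. restrict_class D j (Us ! k) d = cs ! k))"

definition restrict_states :: "system \<Rightarrow> pt set \<Rightarrow> system" where
  "restrict_states S X = S\<lparr>before := X, after := X, dyn := restrict (dyn S) (X \<times> inputs S)\<rparr>"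

text \<open>The data of the counterexample. The points naming states and inputs are arbitrary; the
  outputs 0 and 1 are the real numbers, seen as points of \<open>rspace 1\<close>.\<close>

definition ex_system :: "pt \<Rightarrow> pt \<Rightarrow> pt \<Rightarrow> pt \<Rightarrow> pt \<Rightarrow> pt \<Rightarrow> system" where
  "ex_system s\<^sub>0 s\<^sub>1 s\<^sub>2 s\<^sub>3 a b =
     \<lparr>before = {s\<^sub>0, s\<^sub>1, s\<^sub>2, s\<^sub>3}, after = {s\<^sub>0, s\<^sub>1, s\<^sub>2, s\<^sub>3},
      inputs = {a, b}, outputs = {[0], [1]},
      dyn = (\<lambda>_. undefined)
        ((s\<^sub>0, a) := (s\<^sub>0, [0]), (s\<^sub>0, b) := (s\<^sub>2, [0]),
         (s\<^sub>1, a) := (s\<^sub>1, [1]), (s\<^sub>1, b) := (s\<^sub>1, [1]),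
         (s\<^sub>2, a) := (s\<^sub>1, [1]), (s\<^sub>2, b) := (s\<^sub>1, [1]),
         (s\<^sub>3, a) := (s\<^sub>3, [1]), (s\<^sub>3, b) := (s\<^sub>2, [1]))\<rparr>"

definition ex_judge :: "pt \<Rightarrow> pt \<Rightarrow> pt \<Rightarrow> judge" where
  "ex_judge a b star =
     \<lparr>judged_inputs = {star}, judged_outputs = {[0], [1]},
      judge_in = (\<lambda>i\<in>{a, b}. star), judge_out = (\<lambda>z\<in>{[0], [1]}. z)\<rparr>"

definition ex_machine1 :: "pt \<Rightarrow> pt \<Rightarrow> pt \<Rightarrow> system" where
  "ex_machine1 p\<^sub>0 p\<^sub>1 star =
     \<lparr>before = {p\<^sub>0, p\<^sub>1}, after = {p\<^sub>0, p\<^sub>1}, inputs = {star}, outputs = {[0], [1]},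
      dyn = (\<lambda>_. undefined)((p\<^sub>0, star) := (p\<^sub>0, [0]), (p\<^sub>1, star) := (p\<^sub>1, [1]))\<rparr>"

definition ex_machine2 :: "pt \<Rightarrow> pt \<Rightarrow> system" where
  "ex_machine2 q star =
     \<lparr>before = {q}, after = {q}, inputs = {star}, outputs = {[0], [1]},
      dyn = (\<lambda>_. undefined)((q, star) := (q, [1]))\<rparr>"

end

theory Submission
  imports Defs
begin

text \<open>A morphism sends before-states and after-states by two unrelated maps, and this is where
  gluing breaks down. A section \<open>(S', \<psi>)\<close> over the whole system sends the transitions
  \<open>s\<^sub>0 \<rightarrow> s\<^sub>2\<close> (output 0) and \<open>s\<^sub>3 \<rightarrow> s\<^sub>2\<close> (output 1), both under \<open>b\<close>, to the transitions
  of \<open>S'\<close> under the single judged input out of 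
  \<open>\<psi>\<^sub>b s\<^sub>0\<close> and \<open>\<psi>\<^sub>b s\<^sub>3\<close>. After one step the machine is therefore in the same state
  \<open>\<psi>\<^sub>a s\<^sub>2\<close> in both cases, and its next output is the same. The behaviour prescribed by
  \<open>M\<^sub>1\<close> at \<open>s\<^sub>0\<close> makes that output 0, the one prescribed by \<open>M\<^sub>2\<close> at \<open>s\<^sub>3\<close> makes it 1
  (\<open>no_common_extension\<close>).

  The equivalence relation compares outputs from before-states only. Hence the conflict at the
  after-state \<open>s\<^sub>2\<close> is invisible on the overlap: there \<open>\<psi>\<^sub>1\<close> sends the before-states
  \<open>s\<^sub>1, s\<^sub>2\<close> to the constant-1 state although it sends the after-state \<open>s\<^sub>2\<close> to
  \<open>p\<^sub>0\<close>.

  Two supporting facts make the argument precise: restriction of sections descends to behavioral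
  classes (\<open>restrict_class_beh_class\<close>), which uses that definable maps restrict to definable
  maps, and the systems of the example are finite, hence definable with every subset open.\<close>

section \<open>Definability of finite sets and of restricted maps\<close>

context ominimal
begin

lemma rspace_mem: "rspace n \<in> D n"
  using compl[OF empty[of n]] by simp

lemma inter:
  assumes "A \<in> D n" "B \<in> D n"
  shows "A \<inter> B \<in> D n"
proof -
  have "A \<inter> B = rspace n - ((rspace n - A) \<union> (rspace n - B))"
    using assms subset_rspace by blast
  then show ?thesis
    using assms by (simp add: compl union)
qed

lemma cylinder: "A \<in> D n \<Longrightarrow> {x @ y | x y. x \<in> A \<and> y \<in> rspace k} \<in> D (n + k)"
proof (induction k)
  case 0
  then show ?case by (simp add: rspace_def)
next
  case (Suc k)
  let ?C = "{x @ y | x y. x \<in> A \<and> y \<in> rspace k}"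
  have "{x @ y | x y. x \<in> A \<and> y \<in> rspace (Suc k)} = {z @ [r] | r z. z \<in> ?C}"
  proof (intro equalityI subsetI)
    fix z assume "z \<in> {x @ y | x y. x \<in> A \<and> y \<in> rspace (Suc k)}"
    then obtain x y where xy: "z = x @ y" "x \<in> A" "length y = Suc k"
      by (auto simp: rspace_def)
    then obtain y' r where "y = y' @ [r]" "length y' = k"
      by (metis length_Suc_conv_rev)
    with xy show "z \<in> {z @ [r] | r z. z \<in> ?C}"
      by (force simp: rspace_def)
  qed (force simp: rspace_def)
  then show ?case
    using prod_right[OF Suc.IH[OF Suc.prems]] by simp
qed

text \<open>In dimension one a point is definable because real parameters are allowed; in higher
  dimension it is the intersection of a cylinder over its first coordinate and one over the
  rest.\<close>

lemma singleton_mem: "{x} \<in> D (length x)"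
proof (induction x)
  case Nil
  have "rspace 0 = {[]}" by (auto simp: rspace_def)
  then show ?case using rspace_mem[of 0] by simp
next
  case (Cons r x)
  have "{[r]} \<in> D 1"
    unfolding one_dim by (rule exI[of _ "{{r}}"]) auto
  then have "{u @ y | u y. u \<in> {[r]} \<and> y \<in> rspace (length x)} \<in> D (Suc (length x))"
    using cylinder by fastforce
  moreover have "{r # x} = {u @ y | u y. u \<in> {[r]} \<and> y \<in> rspace (length x)} \<inter> {r # y | r y. y \<in> {x}}"
    by (auto simp: rspace_def)
  ultimately show ?case
    using inter prod_left[OF Cons.IH] by simp
qed

lemma finite_mem:
  assumes "finite A" "A \<subseteq> rspace n"
  shows "A \<in> D n"
  using assms
proof (induction A)
  case empty
  show ?case by (rule ominimal.empty[OF ominimal_axioms])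
next
  case (insert x A)
  then have "{x} \<union> A \<in> D n"
    using singleton_mem[of x] by (intro union) (auto simp: rspace_def)
  then show ?case by simp
qed

lemma finite_definable: "finite A \<Longrightarrow> A \<subseteq> rspace n \<Longrightarrow> definable D A"
  unfolding definable_def using finite_mem by blast

lemma definable_map_finite:
  assumes "finite X" "X \<subseteq> rspace m" "Y \<subseteq> rspace n" "f \<in> X \<rightarrow>\<^sub>E Y"
  shows "definable_map D X Y f"
proof -
  have "finite {x @ f x | x. x \<in> X}"
    using assms(1) by simp
  moreover have "{x @ f x | x. x \<in> X} \<subseteq> rspace (m + n)"
    using assms by (fastforce simp: rspace_def)
  ultimately show ?thesis
    unfolding definable_map_def using finite_definable assms(4) by blast
qed

text \<open>The graph of the restriction is the intersection of the graph with a cylinder over the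
  smaller domain; the two live in the same power of the real line as soon as the domain is
  non-empty.\<close>

lemma definable_map_restrict:
  assumes f: "definable_map D X Y f" and X: "definable D X" and X': "definable D X'" "X' \<subseteq> X"
  shows "definable_map D X' Y (restrict f X')"
proof -
  have "definable D {x @ restrict f X' x | x. x \<in> X'}"
  proof (cases "X' = {}")
    case True
    then show ?thesis using empty by (auto simp: definable_def)
  next
    case False
    then obtain x\<^sub>0 where x\<^sub>0: "x\<^sub>0 \<in> X'" by blast
    obtain m where m: "X \<in> D m" using X by (auto simp: definable_def)
    obtain m' where m': "X' \<in> D m'" using X' by (auto simp: definable_def)
    obtain N where N: "{x @ f x | x. x \<in> X} \<in> D N"
      using f by (auto simp: definable_map_def definable_def)
    have len: "length x = m'" if "x \<in> X" for x
      using subset_rspace[OF m] subset_rspace[OF m'] x\<^sub>0 X'(2) that by (auto simp: rspace_def)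
    have lenf: "m' + length (f x) = N" if "x \<in> X" for x
      using subset_rspace[OF N] len[OF that] that by (auto simp: rspace_def)
    let ?k = "N - m'"
    have "m' + ?k = N" using lenf x\<^sub>0 X'(2) by fastforce
    then have "{x @ y | x y. x \<in> X' \<and> y \<in> rspace ?k} \<in> D N"
      using cylinder[OF m', of ?k] by simp
    from inter[OF N this] have "{x @ f x | x. x \<in> X} \<inter> {x @ y | x y. x \<in> X' \<and> y \<in> rspace ?k} \<in> D N" .
    moreover have "{x @ f x | x. x \<in> X} \<inter> {x @ y | x y. x \<in> X' \<and> y \<in> rspace ?k} =
        {x @ restrict f X' x | x. x \<in> X'}"
    proof (intro equalityI subsetI)
      fix z
      assume "z \<in> {x @ f x | x. x \<in> X} \<inter> {x @ y | x y. x \<in> X' \<and> y \<in> rspace ?k}"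
      then obtain x x' y where *: "z = x @ f x" "x \<in> X" "z = x' @ y" "x' \<in> X'"
        by blast
      then have "x = x'"
        using len X'(2) by (metis append_eq_append_conv subsetD)
      with * show "z \<in> {x @ restrict f X' x | x. x \<in> X'}" by auto
    next
      fix z
      assume "z \<in> {x @ restrict f X' x | x. x \<in> X'}"
      then obtain x where x: "x \<in> X'" "z = x @ f x" by auto
      moreover have "f x \<in> rspace ?k"
        using lenf[of x] x X'(2) by (auto simp: rspace_def)
      ultimately show "z \<in> {x @ f x | x. x \<in> X} \<inter> {x @ y | x y. x \<in> X' \<and> y \<in> rspace ?k}"
        using X'(2) by blast
    qed
    ultimately show ?thesis unfolding definable_def by metis
  qed
  moreover have "restrict f X' \<in> X' \<rightarrow>\<^sub>E Y"
    using f X'(2) by (auto simp: definable_map_def)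
  ultimately show ?thesis by (simp add: definable_map_def)
qed

end

section \<open>Behavioral classes and their restriction\<close>

lemma equiv_beh_equiv: "equiv (judge_sections D j U) (beh_equiv D j U)"
proof (rule equivI)
  show "beh_equiv D j U \<subseteq> judge_sections D j U \<times> judge_sections D j U"
    by (auto simp: beh_equiv_def)
  show "refl_on (judge_sections D j U) (beh_equiv D j U)"
    by (auto simp: beh_equiv_def refl_on_def)
  show "sym (beh_equiv D j U)"
    by (auto simp: beh_equiv_def sym_def)
  show "trans (beh_equiv D j U)"
    by (auto simp: beh_equiv_def trans_def)
qed

lemma beh_equiv_output_seq:
  assumes "((S\<^sub>1, \<psi>\<^sub>1), (S\<^sub>2, \<psi>\<^sub>2)) \<in> beh_equiv D j U" "x \<in> before U" "w \<in> lists (judged_inputs j)"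
  shows "output_seq S\<^sub>1 (on_before \<psi>\<^sub>1 x) w = output_seq S\<^sub>2 (on_before \<psi>\<^sub>2 x) w"
  using assms by (auto simp: beh_equiv_def)

lemma mor_comp_incl:
  "mor_comp V \<psi> (incl V) =
    \<lparr>on_before = restrict (on_before \<psi>) (before V), on_after = restrict (on_after \<psi>) (after V),
     on_inputs = restrict (on_inputs \<psi>) (inputs V), on_outputs = restrict (on_outputs \<psi>) (outputs V)\<rparr>"
  by (auto simp: mor_comp_def incl_def compose_def restrict_def)

lemma incl_morphism_subset:
  assumes "is_morphism D (incl V) V U"
  shows "before V \<subseteq> before U" "after V \<subseteq> after U" "inputs V \<subseteq> inputs U" "outputs V \<subseteq> outputs U"
  using assms by (auto simp: is_morphism_def definable_map_def incl_def PiE_def Pi_def)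

lemma incl_morphism_dyn:
  assumes "is_morphism D (incl V) V U" "s \<in> before V" "i \<in> inputs V"
  shows "dyn U (s, i) = dyn V (s, i)" "dyn V (s, i) \<in> after V \<times> outputs V"
proof -
  show *: "dyn V (s, i) \<in> after V \<times> outputs V"
    using assms unfolding is_morphism_def is_system_def by blast
  have "map_prod (on_after (incl V)) (on_outputs (incl V)) (dyn V (s, i)) =
      dyn U (on_before (incl V) s, on_inputs (incl V) i)"
    using assms by (simp add: is_morphism_def)
  then show "dyn U (s, i) = dyn V (s, i)"
    using assms * by (auto simp: incl_def mem_Times_iff map_prod_def split: prod.splits)
qed

lemma incl_morphism_factor:
  assumes V: "is_morphism D (incl V) V S" and U: "is_morphism D (incl U) U S"
    and sub: "before V \<subseteq> before U" "after V \<subseteq> after U" "inputs V \<subseteq> inputs U" "outputs V \<subseteq> outputs U"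
  shows "is_morphism D (incl V) V U"
proof -
  have "definable_map D A B (\<lambda>x\<in>A. x)" if "definable_map D A C (\<lambda>x\<in>A. x)" "A \<subseteq> B" for A B C
    using that by (auto simp: definable_map_def)
  moreover have "map_prod (\<lambda>x\<in>after V. x) (\<lambda>x\<in>outputs V. x) (dyn V (s, i)) = dyn U (s, i)"
    if "s \<in> before V" "i \<in> inputs V" for s i
    using incl_morphism_dyn[OF V that] incl_morphism_dyn(1)[OF U, of s i] that sub
    by (cases "dyn V (s, i)") auto
  ultimately show ?thesis
    using V U sub by (auto simp: is_morphism_def incl_def)
qed

context ominimal
begin

lemma restrict_sec_section:
  assumes V: "is_morphism D (incl V) V U" and \<sigma>: "\<sigma> \<in> judge_sections D j U"
  shows "restrict_sec V \<sigma> \<in> judge_sections D j V"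
proof -
  obtain S' \<psi> where \<sigma>_eq: "\<sigma> = (S', \<psi>)" by (cases \<sigma>)
  have S': "is_system D S'" "homogeneous S'" "inputs S' = judged_inputs j"
      "outputs S' = judged_outputs j" and \<psi>: "is_morphism D \<psi> U S'"
    and jI: "on_inputs \<psi> = compose (inputs U) (judge_in j) (on_inputs (incl U))"
    and jO: "on_outputs \<psi> = compose (outputs U) (judge_out j) (on_outputs (incl U))"
    using \<sigma> by (auto simp: judge_sections_def \<sigma>_eq)
  note sub = incl_morphism_subset[OF V]
  have sysV: "is_system D V" and sysU: "is_system D U"
    using V by (auto simp: is_morphism_def)
  have "is_morphism D (mor_comp V \<psi> (incl V)) V S'"
    unfolding is_morphism_def mor_comp_incl morphism.simps
  proof (intro conjI ballI)
    show "definable_map D (before V) (before S') (restrict (on_before \<psi>) (before V))"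
      "definable_map D (after V) (after S') (restrict (on_after \<psi>) (after V))"
      "definable_map D (inputs V) (inputs S') (restrict (on_inputs \<psi>) (inputs V))"
      "definable_map D (outputs V) (outputs S') (restrict (on_outputs \<psi>) (outputs V))"
      using \<psi> sub sysV sysU unfolding is_morphism_def is_system_def
      by (blast intro: definable_map_restrict)+
  next
    fix s i assume si: "s \<in> before V" "i \<in> inputs V"
    then have "s \<in> before U" "i \<in> inputs U" using sub by auto
    then have "map_prod (on_after \<psi>) (on_outputs \<psi>) (dyn U (s, i)) =
        dyn S' (on_before \<psi> s, on_inputs \<psi> i)"
      using \<psi> by (simp add: is_morphism_def)
    then show "map_prod (restrict (on_after \<psi>) (after V)) (restrict (on_outputs \<psi>) (outputs V))
        (dyn V (s, i)) =
        dyn S' (restrict (on_before \<psi>) (before V) s, restrict (on_inputs \<psi>) (inputs V) i)"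
      using incl_morphism_dyn[OF V si] si by (cases "dyn V (s, i)") auto
  qed (use sysV S' in auto)
  moreover have "restrict (on_inputs \<psi>) (inputs V) =
      compose (inputs V) (judge_in j) (on_inputs (incl V))"
    using sub by (auto simp: jI compose_def incl_def restrict_def fun_eq_iff)
  moreover have "restrict (on_outputs \<psi>) (outputs V) =
      compose (outputs V) (judge_out j) (on_outputs (incl V))"
    using sub by (auto simp: jO compose_def incl_def restrict_def fun_eq_iff)
  ultimately show ?thesis
    using S' by (simp add: \<sigma>_eq restrict_sec_def judge_sections_def mor_comp_incl)
qed

lemma restrict_sec_beh_equiv:
  assumes V: "is_morphism D (incl V) V U" and "(\<sigma>, \<tau>) \<in> beh_equiv D j U"
  shows "(restrict_sec V \<sigma>, restrict_sec V \<tau>) \<in> beh_equiv D j V"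
proof -
  have "\<sigma> \<in> judge_sections D j U" "\<tau> \<in> judge_sections D j U"
    using assms(2) by (auto simp: beh_equiv_def)
  then have "restrict_sec V \<sigma> \<in> judge_sections D j V" "restrict_sec V \<tau> \<in> judge_sections D j V"
    using restrict_sec_section[OF V] by blast+
  then show ?thesis
    using assms(2) incl_morphism_subset(1)[OF V]
    by (cases \<sigma>; cases \<tau>) (auto simp: beh_equiv_def restrict_sec_def mor_comp_incl)
qed

text \<open>The restriction map on classes is well defined, so it may be computed on any
  representative.\<close>

lemma restrict_class_beh_class:
  assumes V: "is_morphism D (incl V) V U" and \<sigma>: "\<sigma> \<in> judge_sections D j U"
  shows "restrict_class D j V (beh_class D j U \<sigma>) = beh_class D j V (restrict_sec V \<sigma>)"
proof (intro equalityI subsetI)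
  fix \<rho> assume "\<rho> \<in> restrict_class D j V (beh_class D j U \<sigma>)"
  then obtain \<tau> where "(\<sigma>, \<tau>) \<in> beh_equiv D j U" "(restrict_sec V \<tau>, \<rho>) \<in> beh_equiv D j V"
    by (auto simp: restrict_class_def beh_class_def)
  then show "\<rho> \<in> beh_class D j V (restrict_sec V \<sigma>)"
    using restrict_sec_beh_equiv[OF V] equiv_beh_equiv[of D j V]
    unfolding beh_class_def equiv_def by (blast dest: transD)
next
  fix \<rho> assume "\<rho> \<in> beh_class D j V (restrict_sec V \<sigma>)"
  moreover have "\<sigma> \<in> beh_class D j U \<sigma>"
    unfolding beh_class_def by (rule equiv_class_self[OF equiv_beh_equiv \<sigma>])
  ultimately show "\<rho> \<in> restrict_class D j V (beh_class D j U \<sigma>)"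
    by (auto simp: restrict_class_def beh_class_def)
qed

section \<open>Finite systems\<close>

lemma is_system_finite:
  assumes "finite (before S)" "before S \<subseteq> rspace k" "finite (after S)" "after S \<subseteq> rspace k'"
    and "finite (inputs S)" "inputs S \<subseteq> rspace n" "finite (outputs S)" "outputs S \<subseteq> rspace n'"
    and dyn: "dyn S \<in> before S \<times> inputs S \<rightarrow>\<^sub>E after S \<times> outputs S"
  shows "is_system D S"
proof -
  let ?g = "\<lambda>(s, i). s @ i @ fst (dyn S (s, i)) @ snd (dyn S (s, i))"
  let ?G = "{s @ i @ fst (dyn S (s, i)) @ snd (dyn S (s, i)) | s i. s \<in> before S \<and> i \<in> inputs S}"
  have "?G = ?g ` (before S \<times> inputs S)" by auto
  then have "finite ?G" using assms by simp
  moreover have "?G \<subseteq> rspace (k + n + k' + n')"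
  proof
    fix x assume "x \<in> ?G"
    then obtain s i where x: "x = ?g (s, i)" "s \<in> before S" "i \<in> inputs S" by auto
    then have "dyn S (s, i) \<in> after S \<times> outputs S" using dyn by blast
    then show "x \<in> rspace (k + n + k' + n')"
      using x assms by (fastforce simp: rspace_def mem_Times_iff)
  qed
  ultimately show ?thesis
    unfolding is_system_def using assms by (blast intro: finite_definable)
qed

end

text \<open>A point of a finite set has a positive distance to each of the finitely many others.\<close>

lemma open_within_finite:
  assumes "finite X" "X \<subseteq> rspace n" "U \<subseteq> X"
  shows "open_within U X"
proof -
  have "\<exists>e>0. \<forall>y\<in>X. (\<forall>i<length x. \<bar>y ! i - x ! i\<bar> < e) \<longrightarrow> y \<in> U" if "x \<in> U" for x
  proof -
    have len: "length y = length x" if "y \<in> X" for y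
      using that \<open>x \<in> U\<close> assms by (auto simp: rspace_def)
    have "\<exists>i<length x. y ! i \<noteq> x ! i" if "y \<in> X - U" for y
      using that \<open>x \<in> U\<close> len[of y] by (metis DiffD1 DiffD2 nth_equalityI)
    then obtain f where f: "f y < length x" "y ! f y \<noteq> x ! f y" if "y \<in> X - U" for y
      by metis
    let ?d = "\<lambda>y. \<bar>y ! f y - x ! f y\<bar>"
    \<comment> \<open>The 1 covers the case that there is no point outside \<open>U\<close>.\<close>
    let ?e = "Min (insert 1 (?d ` (X - U)))"
    have "?e > 0" using f assms(1) by auto
    moreover have "y \<in> U" if "y \<in> X" and *: "\<forall>i<length x. \<bar>y ! i - x ! i\<bar> < ?e" for y
    proof (rule ccontr)
      assume "y \<notin> U"
      with that have y: "y \<in> X - U" by simp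
      then have "?e \<le> ?d y" using assms(1) by (intro Min_le) auto
      with * f[OF y] show False by force
    qed
    ultimately show ?thesis by blast
  qed
  then show ?thesis
    unfolding open_within_def using assms(3) by blast
qed

lemma (in ominimal) open_immersion_restrict_states:
  assumes fin: "finite (before S)" "before S \<subseteq> rspace m" "after S = before S"
    and io: "finite (inputs S)" "inputs S \<subseteq> rspace n" "finite (outputs S)" "outputs S \<subseteq> rspace n'"
    and dyn: "dyn S \<in> before S \<times> inputs S \<rightarrow>\<^sub>E after S \<times> outputs S"
    and X: "X \<subseteq> before S" "\<And>s i. s \<in> X \<Longrightarrow> i \<in> inputs S \<Longrightarrow> fst (dyn S (s, i)) \<in> X"
  shows "open_immersion D (restrict_states S X) S"
proof -
  let ?U = "restrict_states S X"
  have finX: "finite X" "X \<subseteq> rspace m" using X fin by (auto intro: finite_subset)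
  have dynX: "dyn S (s, i) \<in> X \<times> outputs S" if "s \<in> X" "i \<in> inputs S" for s i
    using that X PiE_mem[OF dyn, of "(s, i)"] by (auto simp: mem_Times_iff)
  have "is_system D S"
    by (rule is_system_finite[OF fin(1,2) _ _ io dyn]) (use fin in auto)
  moreover have "is_system D ?U"
    by (rule is_system_finite[of _ m m n n'])
       (use fin io finX dynX in \<open>auto simp: restrict_states_def\<close>)
  moreover have "definable_map D A B (\<lambda>x\<in>A. x)"
    if "finite B" "A \<subseteq> B" "B \<subseteq> rspace k" for A B k
    by (rule definable_map_finite[of _ k _ k]) (use that in \<open>auto intro: finite_subset\<close>)
  moreover have "map_prod (\<lambda>x\<in>X. x) (\<lambda>x\<in>outputs S. x) (dyn S (s, i)) = dyn S (s, i)"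
    if "s \<in> X" "i \<in> inputs S" for s i
    using dynX[OF that] by (cases "dyn S (s, i)") auto
  ultimately have "is_morphism D (incl ?U) ?U S"
    using fin io X by (auto simp: is_morphism_def incl_def restrict_states_def)
  then show ?thesis
    using fin io X by (auto simp: open_immersion_def restrict_states_def intro: open_within_finite)
qed

section \<open>The obstruction to gluing\<close>

text \<open>Both transitions bring the machine into the state \<open>\<psi>\<^sub>a t\<close>, whatever \<open>\<psi>\<^sub>b\<close> does on
  \<open>t\<close>, so the second outputs come from one and the same state.\<close>

lemma no_common_extension:
  assumes \<sigma>: "(S', \<psi>) \<in> judge_sections D j T"
    and s: "s \<in> before T" "s' \<in> before T" and i: "i \<in> inputs T" "judge_in j i = k"
    and dyn: "dyn T (s, i) = (t, z)" "dyn T (s', i) = (t, z')"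
    and beh: "output_seq S' (on_before \<psi> s) [k, k] = [x, y]"
      "output_seq S' (on_before \<psi> s') [k, k] = [x', y']"
  shows "y = y'"
proof -
  have "map_prod (on_after \<psi>) (on_outputs \<psi>) (dyn T (u, i)) = dyn S' (on_before \<psi> u, k)"
    if "u \<in> before T" for u
    using \<sigma> i that by (auto simp: judge_sections_def is_morphism_def compose_def incl_def)
  from this[OF s(1)] this[OF s(2)]
  have "dyn S' (on_before \<psi> s, k) = (on_after \<psi> t, on_outputs \<psi> z)"
    "dyn S' (on_before \<psi> s', k) = (on_after \<psi> t, on_outputs \<psi> z')"
    using dyn by auto
  with beh show ?thesis by (auto split: prod.splits)
qed

theorem mainTheorem4:
  fixes D :: "nat \<Rightarrow> pt set set"
    and s\<^sub>0 s\<^sub>1 s\<^sub>2 s\<^sub>3 a b p\<^sub>0 p\<^sub>1 q star :: pt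
    and S S\<^sub>1 S\<^sub>2 M\<^sub>1 M\<^sub>2 :: system and j :: judge
  assumes "ominimal D"
    and "{s\<^sub>0, s\<^sub>1, s\<^sub>2, s\<^sub>3} \<subseteq> rspace m" and "distinct [s\<^sub>0, s\<^sub>1, s\<^sub>2, s\<^sub>3]"
    and "{a, b} \<subseteq> rspace n" and "a \<noteq> b"
    and "{p\<^sub>0, p\<^sub>1} \<subseteq> rspace r" and "p\<^sub>0 \<noteq> p\<^sub>1"
  defines "S \<equiv> ex_system s\<^sub>0 s\<^sub>1 s\<^sub>2 s\<^sub>3 a b"
    and "j \<equiv> ex_judge a b star"
    and "S\<^sub>1 \<equiv> restrict_states S {s\<^sub>0, s\<^sub>1, s\<^sub>2}"
    and "S\<^sub>2 \<equiv> restrict_states S {s\<^sub>1, s\<^sub>2, s\<^sub>3}"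
    and "M\<^sub>1 \<equiv> ex_machine1 p\<^sub>0 p\<^sub>1 star"
    and "M\<^sub>2 \<equiv> ex_machine2 q star"
  shows "is_system D S \<and> is_judge D j S \<and> covering D [S\<^sub>1, S\<^sub>2] S \<and>
    overlap S\<^sub>1 S\<^sub>2 = restrict_states S {s\<^sub>1, s\<^sub>2} \<and>
    (\<exists>\<psi>\<^sub>1 \<psi>\<^sub>2.
       (M\<^sub>1, \<psi>\<^sub>1) \<in> judge_sections D j S\<^sub>1 \<and>
       on_before \<psi>\<^sub>1 s\<^sub>0 = p\<^sub>0 \<and> on_before \<psi>\<^sub>1 s\<^sub>1 = p\<^sub>1 \<and> on_before \<psi>\<^sub>1 s\<^sub>2 = p\<^sub>1 \<and>
       (M\<^sub>2, \<psi>\<^sub>2) \<in> judge_sections D j S\<^sub>2 \<and>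
       on_before \<psi>\<^sub>2 s\<^sub>1 = q \<and> on_before \<psi>\<^sub>2 s\<^sub>2 = q \<and> on_before \<psi>\<^sub>2 s\<^sub>3 = q \<and>
       restrict_class D j (overlap S\<^sub>1 S\<^sub>2) (beh_class D j S\<^sub>1 (M\<^sub>1, \<psi>\<^sub>1)) =
       restrict_class D j (overlap S\<^sub>1 S\<^sub>2) (beh_class D j S\<^sub>2 (M\<^sub>2, \<psi>\<^sub>2)) \<and>
       \<not> (\<exists>d\<in>beh_presheaf D j S.
            restrict_class D j S\<^sub>1 d = beh_class D j S\<^sub>1 (M\<^sub>1, \<psi>\<^sub>1) \<and>
            restrict_class D j S\<^sub>2 d = beh_class D j S\<^sub>2 (M\<^sub>2, \<psi>\<^sub>2))) \<and>
    \<not> beh_gluing_axiom D j S"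
proof -
  interpret ominimal D by fact
  have distinct: "distinct [s\<^sub>0, s\<^sub>1, s\<^sub>2, s\<^sub>3]" "a \<noteq> b" "p\<^sub>0 \<noteq> p\<^sub>1"
    \<comment> \<open>The reversed inequations let the simplifier evaluate the updated functions.\<close>
    "distinct [s\<^sub>3, s\<^sub>2, s\<^sub>1, s\<^sub>0]" "b \<noteq> a" "p\<^sub>1 \<noteq> p\<^sub>0"
    using assms(3,5,7) by auto
  have S_dyn: "dyn S \<in> before S \<times> inputs S \<rightarrow>\<^sub>E after S \<times> outputs S"
    using distinct by (auto simp: S_def ex_system_def PiE_def extensional_def)
  have S_fin: "finite (before S)" "before S \<subseteq> rspace m" "after S = before S"
    and S_io: "finite (inputs S)" "inputs S \<subseteq> rspace n" "finite (outputs S)" "outputs S \<subseteq> rspace 1"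
    using assms(2,4) by (auto simp: S_def ex_system_def rspace_def)
  note immersion = open_immersion_restrict_states[OF S_fin S_io S_dyn]
  have S\<^sub>1: "open_immersion D S\<^sub>1 S" and S\<^sub>2: "open_immersion D S\<^sub>2 S"
    unfolding S\<^sub>1_def S\<^sub>2_def using distinct
    by (intro immersion; auto simp: S_def ex_system_def)+
  have "restrict_states S (before S) = S"
    using S_fin S_dyn by (auto simp: restrict_states_def PiE_def extensional_restrict)
  then have S: "open_immersion D S S"
    using immersion[of "before S"] PiE_mem[OF S_dyn] S_fin by (auto simp: mem_Times_iff)
  then have S_sys: "is_system D S"
    by (simp add: open_immersion_def is_morphism_def)
  have cover: "covering D [S\<^sub>1, S\<^sub>2] S"
    using S\<^sub>1 S\<^sub>2 by (auto simp: covering_def S\<^sub>1_def S\<^sub>2_def restrict_states_def S_def ex_system_def)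

  have star_def: "definable D {star}" and out_def: "definable D {[0], [1]}"
    using finite_definable[of "{star}" "length star"] finite_definable[of "{[0], [1]}" 1]
    by (auto simp: rspace_def)
  have judge_maps: "definable_map D {a, b} {star} (judge_in j)"
    "definable_map D {[0], [1]} {[0], [1]} (judge_out j)"
    unfolding j_def ex_judge_def judge.simps
    by (rule definable_map_finite[of _ n _ "length star"] definable_map_finite[of _ 1 _ 1];
        use assms(4) in \<open>auto simp: rspace_def\<close>)+
  then have judge: "is_judge D j S"
    using star_def out_def by (simp add: is_judge_def j_def ex_judge_def S_def ex_system_def)

  have overlap: "overlap S\<^sub>1 S\<^sub>2 = restrict_states S {s\<^sub>1, s\<^sub>2}"
    and overlap': "overlap S\<^sub>2 S\<^sub>1 = overlap S\<^sub>1 S\<^sub>2"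
  proof -
    have "{s\<^sub>0, s\<^sub>1, s\<^sub>2} \<inter> {s\<^sub>1, s\<^sub>2, s\<^sub>3} = {s\<^sub>1, s\<^sub>2}" using distinct by auto
    then show "overlap S\<^sub>1 S\<^sub>2 = restrict_states S {s\<^sub>1, s\<^sub>2}" "overlap S\<^sub>2 S\<^sub>1 = overlap S\<^sub>1 S\<^sub>2"
      by (auto simp: overlap_def S\<^sub>1_def S\<^sub>2_def restrict_states_def S_def ex_system_def
          Int_commute[of "{s\<^sub>1, s\<^sub>2, s\<^sub>3}"] fun_eq_iff restrict_def)
  qed
  have T\<^sub>1: "is_morphism D (incl S\<^sub>1) S\<^sub>1 S" and T\<^sub>2: "is_morphism D (incl S\<^sub>2) S\<^sub>2 S"
    using S\<^sub>1 S\<^sub>2 by (auto simp: open_immersion_def)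
  define V where "V = overlap S\<^sub>1 S\<^sub>2"
  have V: "V = restrict_states S {s\<^sub>1, s\<^sub>2}" by (simp add: V_def overlap)
  have V\<^sub>1: "is_morphism D (incl V) V S\<^sub>1" and V\<^sub>2: "is_morphism D (incl V) V S\<^sub>2"
  proof -
    have "open_immersion D V S"
      unfolding V using distinct by (intro immersion; auto simp: S_def ex_system_def)
    then have "is_morphism D (incl V) V S" by (simp add: open_immersion_def)
    from incl_morphism_factor[OF this T\<^sub>1] incl_morphism_factor[OF this T\<^sub>2]
    show "is_morphism D (incl V) V S\<^sub>1" "is_morphism D (incl V) V S\<^sub>2"
      by (auto simp: V_def overlap_def)
  qed

  \<comment> \<open>The after-state \<open>s\<^sub>2\<close> must go to \<open>p\<^sub>0\<close>, being reached from \<open>s\<^sub>0\<close>, although the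
    before-state \<open>s\<^sub>2\<close> goes to \<open>p\<^sub>1\<close>.\<close>
  define \<psi>\<^sub>1 where "\<psi>\<^sub>1 = \<lparr>on_before = (\<lambda>s\<in>{s\<^sub>0, s\<^sub>1, s\<^sub>2}. if s = s\<^sub>0 then p\<^sub>0 else p\<^sub>1),
    on_after = (\<lambda>s\<in>{s\<^sub>0, s\<^sub>1, s\<^sub>2}. if s = s\<^sub>1 then p\<^sub>1 else p\<^sub>0),
    on_inputs = judge_in j, on_outputs = judge_out j\<rparr>"
  define \<psi>\<^sub>2 where "\<psi>\<^sub>2 = \<lparr>on_before = (\<lambda>s\<in>{s\<^sub>1, s\<^sub>2, s\<^sub>3}. q), on_after = (\<lambda>s\<in>{s\<^sub>1, s\<^sub>2, s\<^sub>3}. q),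
    on_inputs = judge_in j, on_outputs = judge_out j\<rparr>"
  have M\<^sub>1: "is_system D M\<^sub>1"
    by (rule is_system_finite[of _ r r "length star" 1])
       (use assms(6) distinct in \<open>auto simp: M\<^sub>1_def ex_machine1_def rspace_def PiE_def extensional_def\<close>)
  have M\<^sub>2: "is_system D M\<^sub>2"
    by (rule is_system_finite[of _ "length q" "length q" "length star" 1])
       (auto simp: M\<^sub>2_def ex_machine2_def rspace_def PiE_def extensional_def)
  have sec\<^sub>1: "(M\<^sub>1, \<psi>\<^sub>1) \<in> judge_sections D j S\<^sub>1"
  proof -
    have "definable_map D {s\<^sub>0, s\<^sub>1, s\<^sub>2} {p\<^sub>0, p\<^sub>1} (on_before \<psi>\<^sub>1)"
      "definable_map D {s\<^sub>0, s\<^sub>1, s\<^sub>2} {p\<^sub>0, p\<^sub>1} (on_after \<psi>\<^sub>1)"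
      by (rule definable_map_finite[of _ m _ r]; use assms(2,6) in \<open>auto simp: \<psi>\<^sub>1_def\<close>)+
    moreover have "is_system D S\<^sub>1" using S\<^sub>1 by (simp add: open_immersion_def is_morphism_def)
    moreover have "\<forall>s\<in>{s\<^sub>0, s\<^sub>1, s\<^sub>2}. \<forall>i\<in>{a, b}.
        map_prod (on_after \<psi>\<^sub>1) (on_outputs \<psi>\<^sub>1) (dyn S\<^sub>1 (s, i)) =
        dyn M\<^sub>1 (on_before \<psi>\<^sub>1 s, on_inputs \<psi>\<^sub>1 i)"
      using distinct by (simp add: \<psi>\<^sub>1_def M\<^sub>1_def ex_machine1_def S\<^sub>1_def restrict_states_def S_def
          ex_system_def j_def ex_judge_def)
    ultimately have "is_morphism D \<psi>\<^sub>1 S\<^sub>1 M\<^sub>1"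
      using M\<^sub>1 judge_maps unfolding is_morphism_def
      by (simp add: M\<^sub>1_def ex_machine1_def S\<^sub>1_def restrict_states_def S_def ex_system_def \<psi>\<^sub>1_def)
    moreover have "on_inputs \<psi>\<^sub>1 = compose (inputs S\<^sub>1) (judge_in j) (on_inputs (incl S\<^sub>1))"
      "on_outputs \<psi>\<^sub>1 = compose (outputs S\<^sub>1) (judge_out j) (on_outputs (incl S\<^sub>1))"
      by (auto simp: \<psi>\<^sub>1_def compose_def incl_def S\<^sub>1_def restrict_states_def S_def ex_system_def
          j_def ex_judge_def restrict_def fun_eq_iff)
    moreover have "homogeneous M\<^sub>1" "inputs M\<^sub>1 = judged_inputs j" "outputs M\<^sub>1 = judged_outputs j"
      by (simp_all add: homogeneous_def M\<^sub>1_def ex_machine1_def j_def ex_judge_def)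
    ultimately show ?thesis
      using M\<^sub>1 by (simp add: judge_sections_def)
  qed
  have sec\<^sub>2: "(M\<^sub>2, \<psi>\<^sub>2) \<in> judge_sections D j S\<^sub>2"
  proof -
    have "definable_map D {s\<^sub>1, s\<^sub>2, s\<^sub>3} {q} (on_before \<psi>\<^sub>2)"
      "definable_map D {s\<^sub>1, s\<^sub>2, s\<^sub>3} {q} (on_after \<psi>\<^sub>2)"
      by (rule definable_map_finite[of _ m _ "length q"];
          use assms(2) in \<open>auto simp: \<psi>\<^sub>2_def rspace_def\<close>)+
    moreover have "is_system D S\<^sub>2" using S\<^sub>2 by (simp add: open_immersion_def is_morphism_def)
    moreover have "\<forall>s\<in>{s\<^sub>1, s\<^sub>2, s\<^sub>3}. \<forall>i\<in>{a, b}.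
        map_prod (on_after \<psi>\<^sub>2) (on_outputs \<psi>\<^sub>2) (dyn S\<^sub>2 (s, i)) =
        dyn M\<^sub>2 (on_before \<psi>\<^sub>2 s, on_inputs \<psi>\<^sub>2 i)"
      using distinct by (simp add: \<psi>\<^sub>2_def M\<^sub>2_def ex_machine2_def S\<^sub>2_def restrict_states_def S_def
          ex_system_def j_def ex_judge_def)
    ultimately have "is_morphism D \<psi>\<^sub>2 S\<^sub>2 M\<^sub>2"
      using M\<^sub>2 judge_maps unfolding is_morphism_def
      by (simp add: M\<^sub>2_def ex_machine2_def S\<^sub>2_def restrict_states_def S_def ex_system_def \<psi>\<^sub>2_def)
    moreover have "on_inputs \<psi>\<^sub>2 = compose (inputs S\<^sub>2) (judge_in j) (on_inputs (incl S\<^sub>2))"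
      "on_outputs \<psi>\<^sub>2 = compose (outputs S\<^sub>2) (judge_out j) (on_outputs (incl S\<^sub>2))"
      by (auto simp: \<psi>\<^sub>2_def compose_def incl_def S\<^sub>2_def restrict_states_def S_def ex_system_def
          j_def ex_judge_def restrict_def fun_eq_iff)
    moreover have "homogeneous M\<^sub>2" "inputs M\<^sub>2 = judged_inputs j" "outputs M\<^sub>2 = judged_outputs j"
      by (simp_all add: homogeneous_def M\<^sub>2_def ex_machine2_def j_def ex_judge_def)
    ultimately show ?thesis
      using M\<^sub>2 by (simp add: judge_sections_def)
  qed

  let ?c\<^sub>1 = "beh_class D j S\<^sub>1 (M\<^sub>1, \<psi>\<^sub>1)" and ?c\<^sub>2 = "beh_class D j S\<^sub>2 (M\<^sub>2, \<psi>\<^sub>2)"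
  have agree: "restrict_class D j V ?c\<^sub>1 = restrict_class D j V ?c\<^sub>2"
  proof -
    have "output_seq M\<^sub>1 p\<^sub>1 w = output_seq M\<^sub>2 q w" if "w \<in> lists {star}" for w
      using that distinct by (induction w) (auto simp: M\<^sub>1_def ex_machine1_def M\<^sub>2_def ex_machine2_def)
    then have "(restrict_sec V (M\<^sub>1, \<psi>\<^sub>1), restrict_sec V (M\<^sub>2, \<psi>\<^sub>2)) \<in> beh_equiv D j V"
      using restrict_sec_section[OF V\<^sub>1 sec\<^sub>1] restrict_sec_section[OF V\<^sub>2 sec\<^sub>2] distinct
      by (auto simp: beh_equiv_def restrict_sec_def mor_comp_incl \<psi>\<^sub>1_def \<psi>\<^sub>2_def V restrict_states_def
          j_def ex_judge_def)
    then show ?thesis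
      unfolding restrict_class_beh_class[OF V\<^sub>1 sec\<^sub>1] restrict_class_beh_class[OF V\<^sub>2 sec\<^sub>2]
      unfolding beh_class_def by (rule equiv_class_eq[OF equiv_beh_equiv])
  qed

  have no_glue: "\<not> (\<exists>d\<in>beh_presheaf D j S.
      restrict_class D j S\<^sub>1 d = ?c\<^sub>1 \<and> restrict_class D j S\<^sub>2 d = ?c\<^sub>2)"
  proof
    assume "\<exists>d\<in>beh_presheaf D j S. restrict_class D j S\<^sub>1 d = ?c\<^sub>1 \<and> restrict_class D j S\<^sub>2 d = ?c\<^sub>2"
    then obtain S' \<psi> where \<sigma>: "(S', \<psi>) \<in> judge_sections D j S"
      and r\<^sub>1: "restrict_class D j S\<^sub>1 (beh_class D j S (S', \<psi>)) = ?c\<^sub>1"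
      and r\<^sub>2: "restrict_class D j S\<^sub>2 (beh_class D j S (S', \<psi>)) = ?c\<^sub>2"
      by (auto simp: beh_presheaf_def beh_class_def quotient_def)
    have "((S', mor_comp S\<^sub>1 \<psi> (incl S\<^sub>1)), (M\<^sub>1, \<psi>\<^sub>1)) \<in> beh_equiv D j S\<^sub>1"
      using r\<^sub>1 unfolding restrict_class_beh_class[OF T\<^sub>1 \<sigma>]
      unfolding beh_class_def restrict_sec_def prod.case
      by (rule eq_equiv_class[OF _ equiv_beh_equiv sec\<^sub>1])
    from beh_equiv_output_seq[OF this, of s\<^sub>0 "[star, star]"]
    have "output_seq S' (on_before \<psi> s\<^sub>0) [star, star] = output_seq M\<^sub>1 p\<^sub>0 [star, star]"
      by (simp add: mor_comp_incl S\<^sub>1_def restrict_states_def \<psi>\<^sub>1_def j_def ex_judge_def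
          del: output_seq.simps)
    also have "\<dots> = [[0], [0]]" using distinct by (simp add: M\<^sub>1_def ex_machine1_def)
    finally have beh\<^sub>0: "output_seq S' (on_before \<psi> s\<^sub>0) [star, star] = [[0], [0]]" .
    have "((S', mor_comp S\<^sub>2 \<psi> (incl S\<^sub>2)), (M\<^sub>2, \<psi>\<^sub>2)) \<in> beh_equiv D j S\<^sub>2"
      using r\<^sub>2 unfolding restrict_class_beh_class[OF T\<^sub>2 \<sigma>]
      unfolding beh_class_def restrict_sec_def prod.case
      by (rule eq_equiv_class[OF _ equiv_beh_equiv sec\<^sub>2])
    from beh_equiv_output_seq[OF this, of s\<^sub>3 "[star, star]"]
    have "output_seq S' (on_before \<psi> s\<^sub>3) [star, star] = output_seq M\<^sub>2 q [star, star]"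
      by (simp add: mor_comp_incl S\<^sub>2_def restrict_states_def \<psi>\<^sub>2_def j_def ex_judge_def
          del: output_seq.simps)
    also have "\<dots> = [[1], [1]]" by (simp add: M\<^sub>2_def ex_machine2_def)
    finally have beh\<^sub>3: "output_seq S' (on_before \<psi> s\<^sub>3) [star, star] = [[1], [1]]" .
    have "[0] = [1::real]"
    proof (rule no_common_extension[OF \<sigma> _ _ _ _ _ _ beh\<^sub>0 beh\<^sub>3])
      show "dyn S (s\<^sub>0, b) = (s\<^sub>2, [0])" "dyn S (s\<^sub>3, b) = (s\<^sub>2, [1])"
        using distinct by (simp_all add: S_def ex_system_def)
    qed (simp_all add: S_def ex_system_def j_def ex_judge_def)
    then show False by simp
  qed

  have "\<not> beh_gluing_axiom D j S"
  proof
    assume glue: "beh_gluing_axiom D j S"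
    have pre: "?c\<^sub>1 \<in> beh_presheaf D j S\<^sub>1" "?c\<^sub>2 \<in> beh_presheaf D j S\<^sub>2"
      unfolding beh_presheaf_def beh_class_def using sec\<^sub>1 sec\<^sub>2 by (auto intro: quotientI)
    have "\<forall>k<length [S\<^sub>1, S\<^sub>2]. [?c\<^sub>1, ?c\<^sub>2] ! k \<in> beh_presheaf D j ([S\<^sub>1, S\<^sub>2] ! k)"
      using pre by (auto simp: less_Suc_eq)
    moreover have "\<forall>k<length [S\<^sub>1, S\<^sub>2]. \<forall>l<length [S\<^sub>1, S\<^sub>2].
        restrict_class D j (overlap ([S\<^sub>1, S\<^sub>2] ! k) ([S\<^sub>1, S\<^sub>2] ! l)) ([?c\<^sub>1, ?c\<^sub>2] ! k) =
        restrict_class D j (overlap ([S\<^sub>1, S\<^sub>2] ! k) ([S\<^sub>1, S\<^sub>2] ! l)) ([?c\<^sub>1, ?c\<^sub>2] ! l)"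
      using agree by (auto simp: less_Suc_eq V_def overlap')
    ultimately have "\<exists>d\<in>beh_presheaf D j S. \<forall>k<length [S\<^sub>1, S\<^sub>2].
        restrict_class D j ([S\<^sub>1, S\<^sub>2] ! k) d = [?c\<^sub>1, ?c\<^sub>2] ! k"
      using glue[unfolded beh_gluing_axiom_def, rule_format, of S "[S\<^sub>1, S\<^sub>2]" "[?c\<^sub>1, ?c\<^sub>2]"] S cover
      by simp
    then obtain d where d: "d \<in> beh_presheaf D j S"
      and "\<forall>k<length [S\<^sub>1, S\<^sub>2]. restrict_class D j ([S\<^sub>1, S\<^sub>2] ! k) d = [?c\<^sub>1, ?c\<^sub>2] ! k"
      by blast
    from spec[OF this(2), of 0] spec[OF this(2), of 1]
    have "restrict_class D j S\<^sub>1 d = ?c\<^sub>1" "restrict_class D j S\<^sub>2 d = ?c\<^sub>2"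
      by simp_all
    with d no_glue show False by blast
  qed
  moreover have "on_before \<psi>\<^sub>1 s\<^sub>0 = p\<^sub>0 \<and> on_before \<psi>\<^sub>1 s\<^sub>1 = p\<^sub>1 \<and> on_before \<psi>\<^sub>1 s\<^sub>2 = p\<^sub>1"
    "on_before \<psi>\<^sub>2 s\<^sub>1 = q \<and> on_before \<psi>\<^sub>2 s\<^sub>2 = q \<and> on_before \<psi>\<^sub>2 s\<^sub>3 = q"
    using distinct by (auto simp: \<psi>\<^sub>1_def \<psi>\<^sub>2_def)
  ultimately show ?thesis
    using S_sys judge cover overlap sec\<^sub>1 sec\<^sub>2 agree[unfolded V_def] no_glue by blast
qed

end
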